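(* Let $M$ and $N$ be two weighted means (of the same direction), and let $I\subseteq(0,\infty)$ and $J\subseteq(0,\infty)$ be intervals. Let $(f_\alpha)_{\alpha\in\Lambda}$ be an arbitrary (nonempty) family of $MN$-convex functions $f_\alpha:I\to J$, and let $f(u)=\sup_{\alpha\in\Lambda}f_\alpha(u)\in(0,\infty]$ for $u\in I$. If $K=\{x\in I: f(x)<\infty\}$ is nonempty, then $K$ is an interval and $f$ is an $MN$-convex function on $K$ (as a function $K\to(0,\infty)$).
   Context: A function $M:(0,\infty)\times(0,\infty)\times[0,1]\to(0,\infty)$ is called a weighted mean if the following hold. (WM1) $M(u,v,\lambda)=M(v,u,1-\lambda)$. (WM2) $M(u,u,\lambda)=u$. (WM3) $u<M(u,v,\lambda)<v$ whenever $u<v$ and $\lambda\in(0,1)$. (WM4) $M(\alpha u,\alpha v,\lambda)=\alpha M(u,v,\lambda)$ for all $\alpha>0$. (WM5) For fixed $\lambda\in[0,1]$: $M(u,v,\lambda)\le M(w,v,\lambda)$ whenever $u\le w$, and $M(u,v,\lambda)\le M(u,w,\lambda)$ whenever $v\le w$. (WM6) For fixed $u\ne v$, $M(u,v,\cdot)$ is strictly monotone and continuous on $[0,1]$ with range $[\min\{u,v\},\max\{u,v\}]$. Moreover $M$ has a direction: either $M(u,v,\cdot)$ is strictly increasing for all $u<v$ (positive direction; then $M(u,v,0)=u$, $M(u,v,1)=v$ for all $u,v$), or $M(u,v,\cdot)$ is strictly decreasing for all $u<v$ (negative direction; then $M(u,v,0)=v$, $M(u,v,1)=u$ for all $u,v$).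 (WM7) $M(M(u,v,\lambda),M(z,w,\lambda),s)=M(M(u,z,s),M(v,w,s),\lambda)$ for all $u,v,z,w>0$, $s,\lambda\in[0,1]$. (WM8) For all $u,v>0$, $s,\lambda_1,\lambda_2\in[0,1]$: $M(M(u,v,\lambda_1),M(u,v,\lambda_2),s)$ equals $M(u,v,s\lambda_1+(1-s)\lambda_2)$ if $M$ has negative direction, and $M(u,v,(1-s)\lambda_1+s\lambda_2)$ if $M$ has positive direction. Standing assumption: all weighted means occurring together have the same direction. For weighted means $M,N$ and intervals $I,J\subseteq(0,\infty)$, a function $f:I\to J$ is $MN$-convex if $f(M(u,v,\lambda))\le N(f(u),f(v),\lambda)$ for all $u,v\in I$, $\lambda\in[0,1]$. Intervals may be degenerate (a single point). *)

theory Defs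
  imports "HOL-Analysis.Analysis"
begin

text \<open>
  A mean is a total function on the reals; only its values at
  positive \<open>u\<close>, \<open>v\<close> and \<open>l \<in> {0..1}\<close> are constrained.
\<close>

definition positive_direction :: "(real \<Rightarrow> real \<Rightarrow> real \<Rightarrow> real) \<Rightarrow> bool" where
  "positive_direction M \<longleftrightarrow> (\<forall>u v. 0 < u \<and> u < v \<longrightarrow> strict_mono_on {0..1} (M u v))"

definition negative_direction :: "(real \<Rightarrow> real \<Rightarrow> real \<Rightarrow> real) \<Rightarrow> bool" where
  "negative_direction M \<longleftrightarrow> (\<forall>u v. 0 < u \<and> u < v \<longrightarrow> strict_antimono_on {0..1} (M u v))"

definition same_direction ::
  "(real \<Rightarrow> real \<Rightarrow> real \<Rightarrow> real) \<Rightarrow> (real \<Rightarrow> real \<Rightarrow> real \<Rightarrow> real) \<Rightarrow> bool" where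
  "same_direction M N \<longleftrightarrow>
     positive_direction M \<and> positive_direction N \<or> negative_direction M \<and> negative_direction N"

locale weighted_mean =
  fixes M :: "real \<Rightarrow> real \<Rightarrow> real \<Rightarrow> real"
  assumes pos: "\<lbrakk>0 < u; 0 < v; l \<in> {0..1}\<rbrakk> \<Longrightarrow> 0 < M u v l"
    and WM1: "\<lbrakk>0 < u; 0 < v; l \<in> {0..1}\<rbrakk> \<Longrightarrow> M u v l = M v u (1 - l)"
    and WM2: "\<lbrakk>0 < u; l \<in> {0..1}\<rbrakk> \<Longrightarrow> M u u l = u"
    and WM3: "\<lbrakk>0 < u; u < v; l \<in> {0<..<1}\<rbrakk> \<Longrightarrow> u < M u v l \<and> M u v l < v"
    and WM4: "\<lbrakk>0 < a; 0 < u; 0 < v; l \<in> {0..1}\<rbrakk> \<Longrightarrow> M (a * u) (a * v) l = a * M u v l"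
    and WM5_left: "\<lbrakk>0 < u; 0 < v; 0 < w; l \<in> {0..1}; u \<le> w\<rbrakk> \<Longrightarrow> M u v l \<le> M w v l"
    and WM5_right: "\<lbrakk>0 < u; 0 < v; 0 < w; l \<in> {0..1}; v \<le> w\<rbrakk> \<Longrightarrow> M u v l \<le> M u w l"
    and WM6_strict: "\<lbrakk>0 < u; 0 < v; u \<noteq> v\<rbrakk> \<Longrightarrow>
          strict_mono_on {0..1} (M u v) \<or> strict_antimono_on {0..1} (M u v)"
    and WM6_continuous: "\<lbrakk>0 < u; 0 < v; u \<noteq> v\<rbrakk> \<Longrightarrow> continuous_on {0..1} (M u v)"
    and WM6_range: "\<lbrakk>0 < u; 0 < v; u \<noteq> v\<rbrakk> \<Longrightarrow> M u v ` {0..1} = {min u v..max u v}"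
    and WM6_direction: "positive_direction M \<or> negative_direction M"
    and WM7: "\<lbrakk>0 < u; 0 < v; 0 < z; 0 < w; s \<in> {0..1}; l \<in> {0..1}\<rbrakk> \<Longrightarrow>
          M (M u v l) (M z w l) s = M (M u z s) (M v w s) l"
    and WM8_negative:
      "\<lbrakk>negative_direction M; 0 < u; 0 < v; s \<in> {0..1}; l1 \<in> {0..1}; l2 \<in> {0..1}\<rbrakk> \<Longrightarrow>
          M (M u v l1) (M u v l2) s = M u v (s * l1 + (1 - s) * l2)"
    and WM8_positive:
      "\<lbrakk>positive_direction M; 0 < u; 0 < v; s \<in> {0..1}; l1 \<in> {0..1}; l2 \<in> {0..1}\<rbrakk> \<Longrightarrow>
          M (M u v l1) (M u v l2) s = M u v ((1 - s) * l1 + s * l2)"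
begin

text \<open>The endpoint values belonging to each direction follow from the axioms.\<close>

lemma positive_direction_endpoints:
  assumes dir: "positive_direction M" and "0 < u" "0 < v"
  shows "M u v 0 = u" "M u v 1 = v"
proof -
  have ord: "M x y 0 = x \<and> M x y 1 = y" if xy: "0 < x" "x < y" for x y
  proof -
    have mono: "strict_mono_on {0..1} (M x y)" using dir xy by (simp add: positive_direction_def)
    have rng: "M x y ` {0..1} = {x..y}" using WM6_range[of x y] xy by simp
    then have "x \<in> M x y ` {0..1}" "y \<in> M x y ` {0..1}" using xy by simp_all
    then obtain a b where a: "a \<in> {0..1}" "M x y a = x" and b: "b \<in> {0..1}" "M x y b = y"
      by (elim imageE) metis
    have "M x y 0 \<in> {x..y}" "M x y 1 \<in> {x..y}" using rng by auto
    moreover have "M x y 0 \<le> M x y a" "M x y b \<le> M x y 1"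
      using strict_mono_on_leD[OF mono, of 0 a] strict_mono_on_leD[OF mono, of b 1] a b by auto
    ultimately show ?thesis using a b by auto
  qed
  have "M u v 0 = u \<and> M u v 1 = v"
  proof (cases u v rule: linorder_cases)
    case less
    then show ?thesis using ord \<open>0 < u\<close> by blast
  next
    case equal
    then show ?thesis using WM2 \<open>0 < u\<close> by simp
  next
    case greater
    then show ?thesis using ord[of v u] WM1[of u v 0] WM1[of u v 1] \<open>0 < u\<close> \<open>0 < v\<close> by simp
  qed
  then show "M u v 0 = u" "M u v 1 = v" by auto
qed

lemma negative_direction_endpoints:
  assumes dir: "negative_direction M" and "0 < u" "0 < v"
  shows "M u v 0 = v" "M u v 1 = u"
proof -
  have ord: "M x y 0 = y \<and> M x y 1 = x" if xy: "0 < x" "x < y" for x y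
  proof -
    have anti: "strict_antimono_on {0..1} (M x y)" using dir xy by (simp add: negative_direction_def)
    have le: "M x y t \<le> M x y s" if "s \<le> t" "s \<in> {0..1}" "t \<in> {0..1}" for s t
      using monotone_onD[OF anti, of s t] that by (cases "s = t") auto
    have rng: "M x y ` {0..1} = {x..y}" using WM6_range[of x y] xy by simp
    then have "x \<in> M x y ` {0..1}" "y \<in> M x y ` {0..1}" using xy by simp_all
    then obtain a b where a: "a \<in> {0..1}" "M x y a = x" and b: "b \<in> {0..1}" "M x y b = y"
      by (elim imageE) metis
    have "M x y 0 \<in> {x..y}" "M x y 1 \<in> {x..y}" using rng by auto
    moreover have "M x y b \<le> M x y 0" "M x y 1 \<le> M x y a"
      using le[of 0 b] le[of a 1] a b by auto
    ultimately show ?thesis using a b by auto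
  qed
  have "M u v 0 = v \<and> M u v 1 = u"
  proof (cases u v rule: linorder_cases)
    case less
    then show ?thesis using ord \<open>0 < u\<close> by blast
  next
    case equal
    then show ?thesis using WM2 \<open>0 < u\<close> by simp
  next
    case greater
    then show ?thesis using ord[of v u] WM1[of u v 0] WM1[of u v 1] \<open>0 < u\<close> \<open>0 < v\<close> by simp
  qed
  then show "M u v 0 = v" "M u v 1 = u" by auto
qed

end

definition MN_convex ::
  "(real \<Rightarrow> real \<Rightarrow> real \<Rightarrow> real) \<Rightarrow> (real \<Rightarrow> real \<Rightarrow> real \<Rightarrow> real) \<Rightarrow>
   real set \<Rightarrow> real set \<Rightarrow> (real \<Rightarrow> real) \<Rightarrow> bool" where
  "MN_convex M N I J f \<longleftrightarrow>
     f \<in> I \<rightarrow> J \<and> (\<forall>u\<in>I. \<forall>v\<in>I. \<forall>l\<in>{0..1}. f (M u v l) \<le> N (f u) (f v) l)"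

end

theory Submission
  imports Defs
begin

text \<open>For \<open>u\<close>, \<open>v\<close> in \<open>K\<close>, convexity bounds
  \<open>f \<alpha> (M u v l)\<close> by the \<open>N\<close>-mean of \<open>f \<alpha> u\<close>
  and \<open>f \<alpha> v\<close>. Since \<open>N\<close> is monotone in both arguments
  (\<open>mean_mono\<close>), this is at most the \<open>N\<close>-mean of the two suprema, a real
  number independent of \<alpha>. Taking the supremum over \<alpha> shows both that
  \<open>M u v l\<close> stays in \<open>K\<close> and that the convexity inequality holds there. By
  \<open>mean_image\<close> the means of two points fill the whole segment between them, so a set of
  positive reals closed under \<open>M\<close> is an interval.\<close>

lemma (in weighted_mean) mean_image:
  assumes "0 < u" "0 < v"
  shows "M u v ` {0..1} = {min u v..max u v}"
proof (cases "u = v")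
  case True
  then have "M u v ` {0..1} = (\<lambda>_. u) ` {0..1::real}"
    using WM2 \<open>0 < u\<close> by (intro image_cong) auto
  then show ?thesis using True by (simp add: image_constant_conv)
qed (use WM6_range assms in blast)

lemma (in weighted_mean) mean_mono:
  assumes "0 < u" "0 < v" "u \<le> u'" "v \<le> v'" "l \<in> {0..1}"
  shows "M u v l \<le> M u' v' l"
proof -
  have "M u v l \<le> M u' v l" using WM5_left assms by auto
  also have "\<dots> \<le> M u' v' l" using WM5_right assms by auto
  finally show ?thesis .
qed

theorem theorem6:
  fixes M N :: "real \<Rightarrow> real \<Rightarrow> real \<Rightarrow> real"
    and I J K :: "real set"
    and \<Lambda> :: "'i set"
    and f :: "'i \<Rightarrow> real \<Rightarrow> real"
    and F :: "real \<Rightarrow> ereal"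
  assumes "weighted_mean M" and "weighted_mean N" and "same_direction M N"
    and "is_interval I" and "I \<subseteq> {0<..}"
    and "is_interval J" and "J \<subseteq> {0<..}"
    and "\<Lambda> \<noteq> {}"
    and "\<And>\<alpha>. \<alpha> \<in> \<Lambda> \<Longrightarrow> MN_convex M N I J (f \<alpha>)"
    and "\<And>u. u \<in> I \<Longrightarrow> F u = (SUP \<alpha>\<in>\<Lambda>. ereal (f \<alpha> u))"
    and "K = {x \<in> I. F x < \<infinity>}"
    and "K \<noteq> {}"
  shows "is_interval K \<and> MN_convex M N K {0<..} (\<lambda>x. real_of_ereal (F x))"
proof -
  interpret M: weighted_mean M by fact
  interpret N: weighted_mean N by fact
  \<comment> \<open>\<open>real_of_ereal\<close> sends \<infinity> to 0, so \<open>g\<close>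
    represents the supremum only on \<open>K\<close>.\<close>
  define g where "g = (\<lambda>x. real_of_ereal (F x))"
  have K_iff: "x \<in> K \<longleftrightarrow> x \<in> I \<and> F x < \<infinity>" for x
    using assms(11) by blast
  have fpos: "0 < f \<alpha> x" if "\<alpha> \<in> \<Lambda>" "x \<in> I" for \<alpha> x
    using assms(7) assms(9)[OF that(1)] that(2) by (auto simp: MN_convex_def)
  have upper: "ereal (f \<alpha> x) \<le> F x" if "\<alpha> \<in> \<Lambda>" "x \<in> I" for \<alpha> x
    using SUP_upper[OF that(1), of "\<lambda>\<alpha>. ereal (f \<alpha> x)"] by (simp add: assms(10)[OF that(2)])
  have F_eq: "F x = ereal (g x)" if "x \<in> K" for x
  proof -
    \<comment> \<open>Any one member of the family is a real lower bound, which excludes the value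
      -\<infinity>; membership in \<open>K\<close> excludes \<infinity>.\<close>
    obtain \<alpha> where "\<alpha> \<in> \<Lambda>" using \<open>\<Lambda> \<noteq> {}\<close> by blast
    then have "ereal (f \<alpha> x) \<le> F x" "F x < \<infinity>" using upper that K_iff by auto
    then show ?thesis by (cases "F x") (auto simp: g_def)
  qed
  have le_g: "f \<alpha> x \<le> g x" if "\<alpha> \<in> \<Lambda>" "x \<in> K" for \<alpha> x
      proof -
    have "ereal (f \<alpha> x) \<le> ereal (g x)"
      using upper[OF that(1), of x] that(2) unfolding F_eq[OF that(2), symmetric] K_iff by blast
    then show ?thesis by simp
  qed
  have gpos: "0 < g x" if "x \<in> K" for x
  proof -
    obtain \<alpha> where \<alpha>: "\<alpha> \<in> \<Lambda>" using \<open>\<Lambda> \<noteq> {}\<close> by blast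
    have "x \<in> I" using that K_iff by simp
    from fpos[OF \<alpha> this] le_g[OF \<alpha> that] show ?thesis by (rule less_le_trans)
  qed
  have posI: "0 < x" if "x \<in> I" for x
    using that assms(5) by auto
  have key: "M u v l \<in> K \<and> g (M u v l) \<le> N (g u) (g v) l"
    if uv: "u \<in> K" "v \<in> K" and l: "l \<in> {0..1}" for u v l
  proof -
    have uvI: "u \<in> I" "v \<in> I" using uv K_iff by auto
    \<comment> \<open>The mean must first be placed in \<open>I\<close>, because \<open>F\<close> is
      known to be the supremum only there; \<open>min\<close> and \<open>max\<close> avoid ordering
      \<open>u\<close> and \<open>v\<close>.\<close>
    have "min u v \<in> I" "max u v \<in> I" using uvI by (simp_all add: min_def max_def)
    moreover have "M u v l \<in> {min u v..max u v}"
      using M.mean_image[OF posI[OF uvI(1)] posI[OF uvI(2)]] l by blast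
    ultimately have mI: "M u v l \<in> I"
      using assms(4) unfolding is_interval_1 atLeastAtMost_iff by blast
    have "f \<alpha> (M u v l) \<le> N (g u) (g v) l" if \<alpha>: "\<alpha> \<in> \<Lambda>" for \<alpha>
    proof -
      have "f \<alpha> (M u v l) \<le> N (f \<alpha> u) (f \<alpha> v) l"
        using assms(9)[OF \<alpha>] uvI l unfolding MN_convex_def by blast
      also have "\<dots> \<le> N (g u) (g v) l"
        using N.mean_mono[OF fpos[OF \<alpha> uvI(1)] fpos[OF \<alpha> uvI(2)] le_g[OF \<alpha> uv(1)] le_g[OF \<alpha> uv(2)] l] .
      finally show ?thesis .
    qed
    \<comment> \<open>One real bound does double duty: its finiteness gives membership in
      \<open>K\<close>, and then \<open>F_eq\<close> turns it into the inequality for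
      \<open>g\<close>.\<close>
    then have F_le: "F (M u v l) \<le> ereal (N (g u) (g v) l)"
      by (simp add: assms(10)[OF mI] SUP_least)
    also have "\<dots> < \<infinity>" by simp
    finally have mK: "M u v l \<in> K" using mI K_iff by simp
    then show ?thesis using F_le F_eq[OF mK] by simp
  qed
  have "z \<in> K" if "x \<in> K" "y \<in> K" "x \<le> z" "z \<le> y" for x y z
  proof -
    have "x \<in> I" "y \<in> I" using that K_iff by auto
    then have "M x y ` {0..1} = {min x y..max x y}" using M.mean_image posI by blast
    \<comment> \<open>Here surjectivity onto the segment matters: \<open>z\<close> is itself a mean
      of \<open>x\<close> and \<open>y\<close>, whatever the direction of \<open>M\<close>.\<close>
    then have "z \<in> M x y ` {0..1}" using that by simp
    then show ?thesis using key[OF that(1,2)] by auto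
  qed
  then have "is_interval K" unfolding is_interval_1 by blast
  moreover have "MN_convex M N K {0<..} g"
    using gpos key by (auto simp: MN_convex_def)
  ultimately show ?thesis by (simp add: g_def)
qed

end
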